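(* Let $T>0$, $X=[0,T]$, $d\ge 1$, and let $\mathcal{H}_K$ be an $\mathbb{R}^d$-valued reproducing kernel Hilbert space on $X$ with continuous reproducing kernel $K:X\times X\to\mathbb{R}^{d\times d}$. Let $t_1,\dots,t_n\in[0,T]$, $\boldsymbol{y}_1,\dots,\boldsymbol{y}_n\in\mathbb{R}^d$, $\boldsymbol{x}_0\in\mathbb{R}^d$ and $\lambda>0$. Then the regularization problem $$\min_{\boldsymbol{\phi}\in\mathcal{H}_K}\sum_{i=1}^{n}\left\|\boldsymbol{x}_0+\int_0^{t_i}\boldsymbol{\phi}(s)\,ds-\boldsymbol{y}_i\right\|_2^2+\lambda\|\boldsymbol{\phi}\|_{\mathcal{H}_K}^2$$ (integrals taken componentwise) has a unique solution $\boldsymbol{\phi}^*$, and it has the expression $$\boldsymbol{\phi}^*=\sum_{i=1}^{n}\mathcal{L}_i(\Phi(\cdot,v_i)),$$ where $\boldsymbol{v}=(v_1^{\top},\dots,v_n^{\top})^{\top}\in\mathbb{R}^{nd}$ (with $v_i\in\mathbb{R}^d$) is an arbitrary solution of $$\min_{\boldsymbol{v}\in\mathbb{R}^{nd}}\|\mathbf{G}\boldsymbol{v}-\boldsymbol{b}\|_2^2+\lambda\,\boldsymbol{v}^{\top}\mathbf{G}\boldsymbol{v}.$$ Here $\boldsymbol{b}=(b_1^{\top},\dots,b_n^{\top})^{\top}\in\mathbb{R}^{nd}$ with $b_i=\boldsymbol{y}_i-\boldsymbol{x}_0$, and $\mathbf{G}=(G_{ij})_{1\le i,j\le n}\in\mathbb{R}^{nd\times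 nd}$ is the block matrix with $d\times d$ blocks $$G_{ij}=\int_0^{t_i}\left(\int_0^{t_j}K(s,t)\,dt\right)ds .$$
   Context: An $\mathbb{R}^d$-valued reproducing kernel on $X$ is a map $K:X\times X\to\mathbb{R}^{d\times d}$ such that $K(x,x')=K(x',x)^{\top}$ for all $x,x'\in X$, and $\sum_{i,j=1}^{N}\langle K(x_i,x_j)z_j,z_i\rangle_2\ge 0$ for all $N$, all $x_1,\dots,x_N\in X$ and all $z_1,\dots,z_N\in\mathbb{R}^d$, where $\langle\cdot,\cdot\rangle_2$ is the Euclidean inner product on $\mathbb{R}^d$ (with norm $\|\cdot\|_2$). The associated $\mathbb{R}^d$-valued reproducing kernel Hilbert space $\mathcal{H}_K$ is the unique Hilbert space of functions $X\to\mathbb{R}^d$ such that (1) for every $x'\in X$, $v\in\mathbb{R}^d$ the function $K(\cdot,x')v$ lies in $\mathcal{H}_K$, and (2) $\langle\varphi,K(\cdot,x)v\rangle_{\mathcal{H}_K}=\langle\varphi(x),v\rangle_2$ for all $x\in X$, $v\in\mathbb{R}^d$, $\varphi\in\mathcal{H}_K$. When $K$ is continuous, all elements of $\mathcal{H}_K$ are continuous functions. For $t_i\in[0,T]$, $\mathcal{L}_i$ denotes componentwise integration over $[0,t_i]$. The feature map is $\Phi:X\times\mathbb{R}^d\to\mathcal{H}_K$, $\Phi(x,v)=K(\cdot,x)v$. The notation $\mathcal{L}_i(\Phi(\cdot,v))$ means the function on $X$ obtained by integrating in the first argument of $\Phi$: $\mathcal{L}_i(\Phi(\cdot,v))(t)=\int_0^{t_i}K(t,s)v\,ds$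 for $t\in[0,T]$; it is an element of $\mathcal{H}_K$. *)

theory Defs
  imports "HOL-Analysis.Analysis"
begin

definition reproducing_kernel :: "'a set \<Rightarrow> ('a \<Rightarrow> 'a \<Rightarrow> real ^ 'd ^ 'd) \<Rightarrow> bool" where
  "reproducing_kernel X K \<longleftrightarrow>
     (\<forall>x\<in>X. \<forall>x'\<in>X. K x x' = transpose (K x' x)) \<and>
     (\<forall>(N::nat) (x :: nat \<Rightarrow> 'a) (z :: nat \<Rightarrow> real ^ 'd). (\<forall>i<N. x i \<in> X) \<longrightarrow>
        0 \<le> (\<Sum>i<N. \<Sum>j<N. (K (x i) (x j) *v z j) \<bullet> z i))"

definition ip_norm :: "('h \<Rightarrow> 'h \<Rightarrow> real) \<Rightarrow> 'h \<Rightarrow> real" where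
  "ip_norm ip \<phi> = sqrt (ip \<phi> \<phi>)"

text \<open>A function on \<open>X\<close> is represented by the total function that extends it by zero outside
  \<open>X\<close>, so that equality of representatives is equality of functions on \<open>X\<close>. The inner
  product \<open>ip\<close> is constrained only on the carrier \<open>H\<close>.\<close>

locale hilbert_function_space =
  fixes X :: "'a set"
    and H :: "('a \<Rightarrow> 'b::real_vector) set"
    and ip :: "('a \<Rightarrow> 'b) \<Rightarrow> ('a \<Rightarrow> 'b) \<Rightarrow> real"
  assumes zero_outside: "\<phi> \<in> H \<Longrightarrow> x \<notin> X \<Longrightarrow> \<phi> x = 0"
    and zero_mem: "(\<lambda>x. 0) \<in> H"
    and add_mem: "\<phi> \<in> H \<Longrightarrow> \<psi> \<in> H \<Longrightarrow> (\<lambda>x. \<phi> x + \<psi> x) \<in> H"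
    and scaleR_mem: "\<phi> \<in> H \<Longrightarrow> (\<lambda>x. c *\<^sub>R \<phi> x) \<in> H"
    and ip_commute: "\<phi> \<in> H \<Longrightarrow> \<psi> \<in> H \<Longrightarrow> ip \<phi> \<psi> = ip \<psi> \<phi>"
    and ip_add_left: "\<phi> \<in> H \<Longrightarrow> \<psi> \<in> H \<Longrightarrow> \<theta> \<in> H \<Longrightarrow> ip (\<lambda>x. \<phi> x + \<psi> x) \<theta> = ip \<phi> \<theta> + ip \<psi> \<theta>"
    and ip_scaleR_left: "\<phi> \<in> H \<Longrightarrow> \<psi> \<in> H \<Longrightarrow> ip (\<lambda>x. c *\<^sub>R \<phi> x) \<psi> = c * ip \<phi> \<psi>"
    and ip_nonneg: "\<phi> \<in> H \<Longrightarrow> 0 \<le> ip \<phi> \<phi>"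
    and ip_definite: "\<phi> \<in> H \<Longrightarrow> ip \<phi> \<phi> = 0 \<Longrightarrow> \<phi> = (\<lambda>x. 0)"
    and complete: "(\<And>n. \<sigma> n \<in> H) \<Longrightarrow>
      (\<And>e. 0 < e \<Longrightarrow> \<exists>M. \<forall>m\<ge>M. \<forall>n\<ge>M. ip_norm ip (\<lambda>x. \<sigma> m x - \<sigma> n x) < e) \<Longrightarrow>
      \<exists>\<phi>\<in>H. (\<lambda>n. ip_norm ip (\<lambda>x. \<sigma> n x - \<phi> x)) \<longlonglongrightarrow> 0"

definition feature_map ::
    "'a set \<Rightarrow> ('a \<Rightarrow> 'a \<Rightarrow> real ^ 'd ^ 'd) \<Rightarrow> 'a \<Rightarrow> real ^ 'd \<Rightarrow> 'a \<Rightarrow> real ^ 'd" where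
  "feature_map X K x v = (\<lambda>t. if t \<in> X then K t x *v v else 0)"

locale vector_rkhs = hilbert_function_space X H ip
  for X :: "'a set"
    and K :: "'a \<Rightarrow> 'a \<Rightarrow> real ^ 'd ^ 'd"
    and H :: "('a \<Rightarrow> real ^ 'd) set"
    and ip :: "('a \<Rightarrow> real ^ 'd) \<Rightarrow> ('a \<Rightarrow> real ^ 'd) \<Rightarrow> real" +
  assumes kernel: "reproducing_kernel X K"
    and feature_mem: "x \<in> X \<Longrightarrow> feature_map X K x v \<in> H"
    and reproducing: "x \<in> X \<Longrightarrow> \<phi> \<in> H \<Longrightarrow> ip \<phi> (feature_map X K x v) = \<phi> x \<bullet> v"

text \<open>Integration over \<open>{0..\<tau>}\<close> in the first argument of \<open>\<Phi>\<close>, for \<open>F s = \<Phi>(s, v)\<close>;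
  the result is again a function on \<open>X\<close>.\<close>

definition integrate_feature ::
    "real \<Rightarrow> (real \<Rightarrow> real \<Rightarrow> real ^ 'd) \<Rightarrow> real \<Rightarrow> real ^ 'd" where
  "integrate_feature \<tau> F = (\<lambda>t. integral {0..\<tau>} (\<lambda>s. F s t))"

definition rkhs_objective ::
    "((real \<Rightarrow> real ^ 'd) \<Rightarrow> (real \<Rightarrow> real ^ 'd) \<Rightarrow> real) \<Rightarrow> ('n::finite \<Rightarrow> real) \<Rightarrow>
      ('n \<Rightarrow> real ^ 'd) \<Rightarrow> real ^ 'd \<Rightarrow> real \<Rightarrow> (real \<Rightarrow> real ^ 'd) \<Rightarrow> real" where
  "rkhs_objective ip \<tau> y x0 lam \<phi> =
     (\<Sum>i\<in>UNIV. (norm (x0 + integral {0..\<tau> i} \<phi> - y i))\<^sup>2) + lam * (ip_norm ip \<phi>)\<^sup>2"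

text \<open>Vectors in \<open>\<real>\<^sup>n\<^sup>d\<close> are indexed by pairs (block, position within the block).\<close>

definition block :: "real ^ ('n::finite \<times> 'd::finite) \<Rightarrow> 'n \<Rightarrow> real ^ 'd" where
  "block v i = (\<chi> k. v $ (i, k))"

definition gram_block ::
    "(real \<Rightarrow> real \<Rightarrow> real ^ 'd ^ 'd) \<Rightarrow> ('n \<Rightarrow> real) \<Rightarrow> 'n \<Rightarrow> 'n \<Rightarrow> real ^ 'd ^ 'd" where
  "gram_block K \<tau> i j = integral {0..\<tau> i} (\<lambda>s. integral {0..\<tau> j} (\<lambda>t. K s t))"

definition gram ::
    "(real \<Rightarrow> real \<Rightarrow> real ^ 'd ^ 'd) \<Rightarrow> ('n \<Rightarrow> real) \<Rightarrow>
      real ^ ('n::finite \<times> 'd::finite) ^ ('n \<times> 'd)" where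
  "gram K \<tau> = (\<chi> p q. gram_block K \<tau> (fst p) (fst q) $ snd p $ snd q)"

definition data_vector :: "('n \<Rightarrow> real ^ 'd) \<Rightarrow> real ^ 'd \<Rightarrow> real ^ ('n::finite \<times> 'd::finite)" where
  "data_vector y x0 = (\<chi> p. (y (fst p) - x0) $ snd p)"

definition coeff_objective ::
    "real ^ 'm ^ 'm \<Rightarrow> real ^ 'm \<Rightarrow> real \<Rightarrow> real ^ 'm \<Rightarrow> real" where
  "coeff_objective G b lam v = (norm (G *v v - b))\<^sup>2 + lam * (v \<bullet> (G *v v))"

end

theory Submission
  imports Defs
begin

(* Writing A f for the stacked vector of the integrals of f over the intervals and L for its
  adjoint, the first objective is J f = |A f - b|^2 + lam |f|^2; moreover A L = G, and the second
  objective is J (L v). If v solves the nonsingular system (G + lam I) v = b, then the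
  cross terms of J (L v + h) cancel and leave J (L v) + |A h|^2 + lam |h|^2, so that L v is the
  unique minimiser of J, and the minimisers of the second objective are exactly the vectors
  that L maps to it. The values of L lie in H because the integral functionals are bounded on H,
  and the reproducing property identifies their Riesz representers. *)

section \<open>Inner product algebra, the Cauchy-Schwarz inequality and the Riesz representation
  theorem\<close>

context hilbert_function_space
begin

lemma ip_add_right:
  assumes "\<phi> \<in> H" "\<psi> \<in> H" "\<theta> \<in> H"
  shows "ip \<theta> (\<lambda>x. \<phi> x + \<psi> x) = ip \<theta> \<phi> + ip \<theta> \<psi>"
  using ip_add_left[OF assms] ip_commute assms add_mem by metis

lemma ip_scaleR_right:
  assumes "\<phi> \<in> H" "\<theta> \<in> H"
  shows "ip \<theta> (\<lambda>x. c *\<^sub>R \<phi> x) = c * ip \<theta> \<phi>"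
  using ip_scaleR_left[OF assms] ip_commute assms scaleR_mem by metis

lemma ip_zero_right: "\<phi> \<in> H \<Longrightarrow> ip \<phi> (\<lambda>x. 0) = 0"
  using ip_scaleR_right[of \<phi> \<phi> 0] by simp

lemma diff_mem: "\<phi> \<in> H \<Longrightarrow> \<psi> \<in> H \<Longrightarrow> (\<lambda>x. \<phi> x - \<psi> x) \<in> H"
  using add_mem[OF _ scaleR_mem[of \<psi> "-1"], of \<phi>] by simp

lemma ip_diff_left:
  assumes "\<phi> \<in> H" "\<psi> \<in> H" "\<theta> \<in> H"
  shows "ip (\<lambda>x. \<phi> x - \<psi> x) \<theta> = ip \<phi> \<theta> - ip \<psi> \<theta>"
  using ip_add_left[OF assms(1) scaleR_mem[OF assms(2), of "-1"] assms(3)]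
    ip_scaleR_left[OF assms(2,3), of "-1"] by simp

lemma ip_diff_right:
  assumes "\<phi> \<in> H" "\<psi> \<in> H" "\<theta> \<in> H"
  shows "ip \<theta> (\<lambda>x. \<phi> x - \<psi> x) = ip \<theta> \<phi> - ip \<theta> \<psi>"
  using ip_diff_left[OF assms] ip_commute assms diff_mem by metis

lemma sum_mem:
  "finite I \<Longrightarrow> (\<And>i. i \<in> I \<Longrightarrow> f i \<in> H) \<Longrightarrow> (\<lambda>x. \<Sum>i\<in>I. f i x) \<in> H"
  by (induction I rule: finite_induct) (auto simp: zero_mem add_mem)

lemma ip_sum_right:
  assumes "finite I" "\<And>i. i \<in> I \<Longrightarrow> f i \<in> H" "\<theta> \<in> H"
  shows "ip \<theta> (\<lambda>x. \<Sum>i\<in>I. f i x) = (\<Sum>i\<in>I. ip \<theta> (f i))"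
  using assms by (induction I rule: finite_induct) (auto simp: ip_zero_right ip_add_right sum_mem)

lemma ip_norm_nonneg: "\<phi> \<in> H \<Longrightarrow> 0 \<le> ip_norm ip \<phi>"
  by (simp add: ip_norm_def ip_nonneg)

lemma ip_norm_power2: "\<phi> \<in> H \<Longrightarrow> (ip_norm ip \<phi>)\<^sup>2 = ip \<phi> \<phi>"
  by (simp add: ip_norm_def ip_nonneg)

text \<open>The quadratic in \<open>c\<close> behind several later arguments: it is minimised for
  Cauchy-Schwarz, gives the squared distance at \<open>c = -1\<close> and the squared norm of a sum
  at \<open>c = 1\<close>, and yields the first variation in the Riesz argument.\<close>

lemma ip_add_scaleR_self:
  assumes "\<phi> \<in> H" "\<psi> \<in> H"
  shows "ip (\<lambda>x. \<phi> x + c *\<^sub>R \<psi> x) (\<lambda>x. \<phi> x + c *\<^sub>R \<psi> x) =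
    ip \<phi> \<phi> + 2 * c * ip \<phi> \<psi> + c\<^sup>2 * ip \<psi> \<psi>"
  using assms ip_commute[OF assms]
  by (simp add: ip_add_left ip_add_right ip_scaleR_left ip_scaleR_right add_mem scaleR_mem
      power2_eq_square algebra_simps)

lemma ip_diff_self:
  assumes "\<phi> \<in> H" "\<psi> \<in> H"
  shows "ip (\<lambda>x. \<phi> x - \<psi> x) (\<lambda>x. \<phi> x - \<psi> x) = ip \<phi> \<phi> - 2 * ip \<phi> \<psi> + ip \<psi> \<psi>"
  using ip_add_scaleR_self[OF assms, of "-1"] by simp

lemma cauchy_schwarz:
  assumes "\<phi> \<in> H" "\<psi> \<in> H"
  shows "\<bar>ip \<phi> \<psi>\<bar> \<le> ip_norm ip \<phi> * ip_norm ip \<psi>"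
proof (cases "ip \<psi> \<psi> = 0")
  case True
  with ip_definite[OF assms(2)] have "ip \<phi> \<psi> = 0"
    using ip_zero_right assms by auto
  then show ?thesis
    using assms by (simp add: ip_norm_nonneg)
next
  case False
  define q where "q = ip \<psi> \<psi>"
  have q: "q > 0"
    using False ip_nonneg[OF assms(2)] by (simp add: q_def)
  \<comment> \<open>The coefficient \<open>- ip \<phi> \<psi> / q\<close> minimises the squared norm
    of \<phi> + c \<psi> over c.\<close>
  have "0 \<le> ip \<phi> \<phi> + 2 * (- ip \<phi> \<psi> / q) * ip \<phi> \<psi> + (- ip \<phi> \<psi> / q)\<^sup>2 * q"
    unfolding q_def ip_add_scaleR_self[OF assms, symmetric]
    by (intro ip_nonneg add_mem scaleR_mem assms)
  also have "\<dots> = ip \<phi> \<phi> - (ip \<phi> \<psi>)\<^sup>2 / q"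
    using q by (simp add: field_simps power2_eq_square)
  finally have "(ip \<phi> \<psi>)\<^sup>2 \<le> ip \<phi> \<phi> * ip \<psi> \<psi>"
    using q by (simp add: field_simps q_def)
  then have "sqrt ((ip \<phi> \<psi>)\<^sup>2) \<le> sqrt (ip \<phi> \<phi> * ip \<psi> \<psi>)"
    by (rule real_sqrt_le_mono)
  then show ?thesis
    by (simp add: ip_norm_def real_sqrt_mult)
qed

text \<open>The representer is the limit of a minimising sequence of \<open>\<phi> \<mapsto> ip \<phi> \<phi> - 2 * F \<phi>\<close>, which is
  Cauchy by the parallelogram law.\<close>

lemma riesz_representation:
  fixes F :: "('a \<Rightarrow> 'b) \<Rightarrow> real"
  assumes add: "\<And>\<phi> \<psi>. \<phi> \<in> H \<Longrightarrow> \<psi> \<in> H \<Longrightarrow> F (\<lambda>x. \<phi> x + \<psi> x) = F \<phi> + F \<psi>"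
    and scale: "\<And>c \<phi>. \<phi> \<in> H \<Longrightarrow> F (\<lambda>x. c *\<^sub>R \<phi> x) = c * F \<phi>"
    and bounded: "\<And>\<phi>. \<phi> \<in> H \<Longrightarrow> \<bar>F \<phi>\<bar> \<le> C * ip_norm ip \<phi>"
  shows "\<exists>g\<in>H. \<forall>\<phi>\<in>H. ip \<phi> g = F \<phi>"
proof -
  define J where "J \<phi> = ip \<phi> \<phi> - 2 * F \<phi>" for \<phi>
  have J_lower: "- C\<^sup>2 \<le> J \<phi>" if "\<phi> \<in> H" for \<phi>
  proof -
    \<comment> \<open>Completing the square: with N the norm of \<phi>, the bound on
      \<open>F\<close> gives J \<phi> \<ge> N^2 - 2 C N = (N - C)^2 - C^2.\<close>
    have "0 \<le> (ip_norm ip \<phi> - C)\<^sup>2"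
      by simp
    then show ?thesis
      using bounded[OF that] ip_norm_power2[OF that]
      by (simp add: J_def power2_eq_square algebra_simps)
  qed
  define m where "m = Inf (J ` H)"
  have m_le: "m \<le> J \<phi>" if "\<phi> \<in> H" for \<phi>
    unfolding m_def using that J_lower by (intro cInf_lower bdd_belowI2) auto
  have "\<exists>\<phi>\<in>H. J \<phi> < m + 1 / real (Suc n)" for n
  proof -
    have "Inf (J ` H) < m + 1 / real (Suc n)"
      by (simp add: m_def)
    from cInf_lessD[OF _ this] zero_mem show ?thesis
      by auto
  qed
  then obtain \<sigma> where \<sigma>: "\<And>n. \<sigma> n \<in> H" and J_\<sigma>: "\<And>n. J (\<sigma> n) < m + 1 / real (Suc n)"
    by metis
  \<comment> \<open>The linear coefficient is twice the defect
    \<open>ip \<phi> \<psi> - F \<psi>\<close>, which has to vanish in the limit.\<close>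
  have J_step: "J (\<lambda>x. \<phi> x + c *\<^sub>R \<psi> x) = J \<phi> + 2 * c * (ip \<phi> \<psi> - F \<psi>) + c\<^sup>2 * ip \<psi> \<psi>"
    if "\<phi> \<in> H" "\<psi> \<in> H" for \<phi> \<psi> c
    using that by (simp add: J_def ip_add_scaleR_self add scale scaleR_mem algebra_simps)
  \<comment> \<open>By the parallelogram law the left side equals 2 J \<phi> + 2 J \<psi> - 4 J at
    the midpoint, since the contributions of \<open>F\<close> cancel; at the midpoint
    \<open>J\<close> is at least \<open>m\<close>.\<close>
  have dist: "ip (\<lambda>x. \<phi> x - \<psi> x) (\<lambda>x. \<phi> x - \<psi> x) \<le> 2 * (J \<phi> - m) + 2 * (J \<psi> - m)"
    if "\<phi> \<in> H" "\<psi> \<in> H" for \<phi> \<psi>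
  proof -
    have mid: "(\<lambda>x. (1/2) *\<^sub>R (\<phi> x + 1 *\<^sub>R \<psi> x)) \<in> H"
      using that by (simp add: add_mem scaleR_mem)
    have "J (\<lambda>x. (1/2) *\<^sub>R (\<phi> x + 1 *\<^sub>R \<psi> x)) =
        (ip \<phi> \<phi> + 2 * ip \<phi> \<psi> + ip \<psi> \<psi>) / 4 - (F \<phi> + F \<psi>)"
      unfolding J_def
      using ip_add_scaleR_self[OF that, of 1] that
      by (simp add: ip_scaleR_left ip_scaleR_right add scale add_mem scaleR_mem)
        (simp add: field_simps)
    with m_le[OF mid] ip_diff_self[OF that] show ?thesis
      unfolding J_def[of \<phi>] J_def[of \<psi>] by argo
  qed
  have "\<exists>M. \<forall>p\<ge>M. \<forall>q\<ge>M. ip_norm ip (\<lambda>x. \<sigma> p x - \<sigma> q x) < e" if e: "0 < e" for e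
  proof -
    \<comment> \<open>\<open>dist\<close> bounds the squared distance by four times an excess over
      \<open>m\<close> of less than 1 / Suc M, hence the quarter of e^2.\<close>
    obtain M where M: "inverse (real (Suc M)) < e\<^sup>2 / 4"
      using reals_Archimedean[of "e\<^sup>2 / 4"] e by auto
    have "ip_norm ip (\<lambda>x. \<sigma> p x - \<sigma> q x) < e" if "M \<le> p" "M \<le> q" for p q
    proof -
      have "1 / real (Suc p) \<le> inverse (real (Suc M))" "1 / real (Suc q) \<le> inverse (real (Suc M))"
        using that by (simp_all add: field_simps)
      then have "ip (\<lambda>x. \<sigma> p x - \<sigma> q x) (\<lambda>x. \<sigma> p x - \<sigma> q x) < e\<^sup>2"
        using dist[OF \<sigma> \<sigma>, of p q] J_\<sigma>[of p] J_\<sigma>[of q] M by argo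
      then show ?thesis
        unfolding ip_norm_def using e by (simp add: real_less_lsqrt)
    qed
    then show ?thesis
      by blast
  qed
  then obtain g where g: "g \<in> H" and lim: "(\<lambda>n. ip_norm ip (\<lambda>x. \<sigma> n x - g x)) \<longlonglongrightarrow> 0"
    using complete[of \<sigma>] \<sigma> by blast
  have "ip \<psi> g = F \<psi>" if \<psi>: "\<psi> \<in> H" for \<psi>
  proof -
    \<comment> \<open>Cauchy-Schwarz turns convergence in norm into convergence of the inner
      products with the fixed \<psi>.\<close>
    have "(\<lambda>n. ip (\<sigma> n) \<psi> - ip g \<psi>) \<longlonglongrightarrow> 0"
    proof (rule Lim_null_comparison)
      show "\<forall>\<^sub>F n in sequentially.
          norm (ip (\<sigma> n) \<psi> - ip g \<psi>) \<le> ip_norm ip (\<lambda>x. \<sigma> n x - g x) * ip_norm ip \<psi>"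
        using cauchy_schwarz[OF diff_mem[OF \<sigma> g] \<psi>] ip_diff_left[OF \<sigma> g \<psi>] by simp
      show "(\<lambda>n. ip_norm ip (\<lambda>x. \<sigma> n x - g x) * ip_norm ip \<psi>) \<longlonglongrightarrow> 0"
        using tendsto_mult_right[OF lim] by simp
    qed
    then have weak: "(\<lambda>n. ip (\<sigma> n) \<psi>) \<longlonglongrightarrow> ip g \<psi>"
      by (rule LIM_zero_cancel)
    define d where "d = ip g \<psi> - F \<psi>"
    \<comment> \<open>Moving from \<open>\<sigma> n\<close> in direction \<psi> can lower
      \<open>J\<close> by at most 1 / Suc n, as \<open>J\<close> stays above \<open>m\<close>. The
      inequality is the limit of these bounds.\<close>
    have variation: "0 \<le> 2 * c * d + c\<^sup>2 * ip \<psi> \<psi>" for c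
    proof (rule LIMSEQ_le)
      show "(\<lambda>n. - (1 / real (Suc n))) \<longlonglongrightarrow> 0"
        using tendsto_minus[OF lim_1_over_n[THEN LIMSEQ_Suc]] by simp
      show "(\<lambda>n. 2 * c * (ip (\<sigma> n) \<psi> - F \<psi>) + c\<^sup>2 * ip \<psi> \<psi>) \<longlonglongrightarrow> 2 * c * d + c\<^sup>2 * ip \<psi> \<psi>"
        unfolding d_def by (intro tendsto_intros weak)
      have "- (1 / real (Suc n)) \<le> 2 * c * (ip (\<sigma> n) \<psi> - F \<psi>) + c\<^sup>2 * ip \<psi> \<psi>" for n
        using m_le[OF add_mem[OF \<sigma> scaleR_mem[OF \<psi>]], of n c] J_step[OF \<sigma> \<psi>, of n c] J_\<sigma>[of n]
        by linarith
      then show "\<exists>N. \<forall>n\<ge>N. - (1 / real (Suc n)) \<le>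
          2 * c * (ip (\<sigma> n) \<psi> - F \<psi>) + c\<^sup>2 * ip \<psi> \<psi>"
        by blast
    qed
    \<comment> \<open>Adding 1 keeps \<open>q\<close> positive even for \<psi> = 0. At c = - d / q
      the variation is - d^2 (q + 1) / q^2, which is nonnegative only if d = 0.\<close>
    define q where "q = ip \<psi> \<psi> + 1"
    have q: "q > 0"
      using ip_nonneg[OF \<psi>] by (simp add: q_def)
    have "0 \<le> 2 * (- d / q) * d + (- d / q)\<^sup>2 * (q - 1)"
      using variation[of "- d / q"] by (simp add: q_def)
    also have "\<dots> = - (d\<^sup>2 * (q + 1) / q\<^sup>2)"
      using q by (simp add: field_simps power2_eq_square)
    finally have "d\<^sup>2 * (q + 1) \<le> 0"
      using q by (simp add: divide_le_0_iff)
    then have "d = 0"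
      using q by (simp add: mult_le_0_iff)
    then show ?thesis
      using ip_commute[OF g \<psi>] by (simp add: d_def)
  qed
  with g show ?thesis
    by blast
qed

end

section \<open>Continuity of the elements of the space, and representers of the integral
  functionals\<close>

lemma bounded_linear_matrix_vector_mult_left:
  "bounded_linear (\<lambda>A :: real ^ 'n ^ 'm. A *v w)"
  by (intro linear_conv_bounded_linear[THEN iffD1] linearI)
    (auto simp: matrix_vector_mult_add_rdistrib scaleR_matrix_vector_assoc)

locale continuous_rkhs = vector_rkhs "{0..T}" K H ip
  for T :: real
    and K :: "real \<Rightarrow> real \<Rightarrow> real ^ 'd ^ 'd"
    and H :: "(real \<Rightarrow> real ^ 'd) set"
    and ip :: "(real \<Rightarrow> real ^ 'd) \<Rightarrow> (real \<Rightarrow> real ^ 'd) \<Rightarrow> real" +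
  assumes continuous_kernel: "continuous_on ({0..T} \<times> {0..T}) (\<lambda>(s, t). K s t)"
begin

abbreviation feature :: "real \<Rightarrow> real ^ 'd \<Rightarrow> real \<Rightarrow> real ^ 'd" where
  "feature \<equiv> feature_map {0..T} K"

lemma kernel_transpose: "s \<in> {0..T} \<Longrightarrow> t \<in> {0..T} \<Longrightarrow> K s t = transpose (K t s)"
  using kernel unfolding reproducing_kernel_def by blast

lemma kernel_inner:
  "s \<in> {0..T} \<Longrightarrow> t \<in> {0..T} \<Longrightarrow> (K s t *v v) \<bullet> w = (K t s *v w) \<bullet> v"
  by (simp add: kernel_transpose[of s t] transpose_matrix_vector dot_lmul_matrix)
    (rule inner_commute)

lemma continuous_on_kernel:
  assumes "continuous_on S f" "continuous_on S g" "f ` S \<subseteq> {0..T}" "g ` S \<subseteq> {0..T}"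
  shows "continuous_on S (\<lambda>x. K (f x) (g x))"
  using continuous_on_compose2[OF continuous_kernel continuous_on_Pair[OF assms(1,2)]] assms(3,4)
  by auto

lemma continuous_on_kernel_mult:
  assumes "continuous_on S f" "continuous_on S g" "f ` S \<subseteq> {0..T}" "g ` S \<subseteq> {0..T}"
  shows "continuous_on S (\<lambda>x. K (f x) (g x) *v v)"
  by (rule bounded_linear.continuous_on[OF bounded_linear_matrix_vector_mult_left
        continuous_on_kernel[OF assms]])

lemma ip_feature_feature:
  "s \<in> {0..T} \<Longrightarrow> t \<in> {0..T} \<Longrightarrow> ip (feature s v) (feature t w) = (K t s *v v) \<bullet> w"
  by (simp add: reproducing feature_mem) (simp add: feature_map_def)

text \<open>The reproducing property writes the increment of \<phi> as an inner product with a
  difference of two features. Cauchy-Schwarz reduces the claim to continuity of the features in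
  norm, which the kernel controls.\<close>

lemma continuous_on_mem:
  assumes \<phi>: "\<phi> \<in> H"
  shows "continuous_on {0..T} \<phi>"
  unfolding continuous_on_componentwise[of _ \<phi>]
proof
  fix v :: "real ^ 'd"
  show "continuous_on {0..T} (\<lambda>s. \<phi> s \<bullet> v)"
    unfolding continuous_on_def
  proof
    fix t assume t: "t \<in> {0..T}"
    \<comment> \<open>The squared distance between \<open>feature s v\<close> and
      \<open>feature t v\<close>, written in kernel values.\<close>
    define q where "q s = (K s s *v v) \<bullet> v - 2 * ((K t s *v v) \<bullet> v) + (K t t *v v) \<bullet> v" for s
    have "continuous_on {0..T} q"
      unfolding q_def using t by (intro continuous_intros continuous_on_kernel_mult) auto
    then have "(q \<longlongrightarrow> q t) (at t within {0..T})"
      using t by (auto simp: continuous_on_def)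
    moreover have "q t = 0"
      by (simp add: q_def)
    ultimately have "((\<lambda>s. ip_norm ip \<phi> * sqrt (q s)) \<longlongrightarrow> ip_norm ip \<phi> * sqrt 0)
        (at t within {0..T})"
      by (intro tendsto_intros) auto
    then have lim: "((\<lambda>s. ip_norm ip \<phi> * sqrt (q s)) \<longlongrightarrow> 0) (at t within {0..T})"
      by simp
    have "norm (\<phi> s \<bullet> v - \<phi> t \<bullet> v) \<le> ip_norm ip \<phi> * sqrt (q s)" if s: "s \<in> {0..T}" for s
    proof -
      have "\<phi> s \<bullet> v - \<phi> t \<bullet> v = ip \<phi> (\<lambda>x. feature s v x - feature t v x)"
        using s t \<phi> by (simp add: ip_diff_right feature_mem reproducing)
      moreover have "ip_norm ip (\<lambda>x. feature s v x - feature t v x) = sqrt (q s)"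
        using s t by (simp add: ip_norm_def ip_diff_self feature_mem ip_feature_feature q_def)
      ultimately show ?thesis
        using cauchy_schwarz[OF \<phi> diff_mem[OF feature_mem[OF s] feature_mem[OF t]], of v v] by simp
    qed
    then have "((\<lambda>s. \<phi> s \<bullet> v - \<phi> t \<bullet> v) \<longlongrightarrow> 0) (at t within {0..T})"
      by (intro Lim_null_comparison[OF _ lim]) (auto simp: eventually_at_filter)
    then show "((\<lambda>s. \<phi> s \<bullet> v) \<longlongrightarrow> \<phi> t \<bullet> v) (at t within {0..T})"
      by (rule LIM_zero_cancel)
  qed
qed

lemma continuous_on_mem_subinterval:
  "\<phi> \<in> H \<Longrightarrow> a \<in> {0..T} \<Longrightarrow> continuous_on {0..a} \<phi>"
  by (rule continuous_on_subset[OF continuous_on_mem]) auto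

lemma integrable_mem: "\<phi> \<in> H \<Longrightarrow> a \<in> {0..T} \<Longrightarrow> \<phi> integrable_on {0..a}"
  by (intro integrable_continuous_interval continuous_on_mem_subinterval)

text \<open>Supplies the boundedness that \<open>riesz_representation\<close> asks for. Pointwise,
  the integrand is at most the norm of \<phi> times the norm of the feature at s, and the latter is
  bounded because the kernel is continuous on a compact interval.\<close>

lemma integral_inner_bounded:
  assumes a: "a \<in> {0..T}"
  obtains C where "\<And>\<phi>. \<phi> \<in> H \<Longrightarrow> \<bar>integral {0..a} \<phi> \<bullet> v\<bar> \<le> C * ip_norm ip \<phi>"
proof -
  have "continuous_on {0..T} (\<lambda>s. sqrt ((K s s *v v) \<bullet> v))"
    by (intro continuous_intros continuous_on_kernel_mult) auto
  then have "bounded ((\<lambda>s. sqrt ((K s s *v v) \<bullet> v)) ` {0..T})"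
    by (intro compact_imp_bounded compact_continuous_image) auto
  then obtain B where "\<forall>s\<in>{0..T}. \<bar>sqrt ((K s s *v v) \<bullet> v)\<bar> \<le> B"
    unfolding bounded_iff by auto
  then have B: "\<bar>sqrt ((K s s *v v) \<bullet> v)\<bar> \<le> B" if "s \<in> {0..T}" for s
    using that by blast
  have "\<bar>integral {0..a} \<phi> \<bullet> v\<bar> \<le> (B * a) * ip_norm ip \<phi>" if \<phi>: "\<phi> \<in> H" for \<phi>
  proof -
    have eq: "integral {0..a} \<phi> \<bullet> v = integral {0..a} (\<lambda>s. \<phi> s \<bullet> v)"
      using integral_linear[OF integrable_mem[OF \<phi> a] bounded_linear_inner_left] by (simp add: o_def)
    have "norm (integral {0..a} (\<lambda>s. \<phi> s \<bullet> v)) \<le> (ip_norm ip \<phi> * B) * (a - 0)"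
    proof (rule integral_bound)
      show "continuous_on {0..a} (\<lambda>s. \<phi> s \<bullet> v)"
        by (intro continuous_intros continuous_on_mem_subinterval \<phi> a)
      fix s assume "s \<in> {0..a}"
      then have s: "s \<in> {0..T}"
        using a by auto
      have "norm (\<phi> s \<bullet> v) \<le> ip_norm ip \<phi> * ip_norm ip (feature s v)"
        using cauchy_schwarz[OF \<phi> feature_mem[OF s]] reproducing[OF s \<phi>] by simp
      also have "ip_norm ip (feature s v) \<le> B"
        using B[OF s] s by (simp add: ip_norm_def ip_feature_feature)
      finally show "norm (\<phi> s \<bullet> v) \<le> ip_norm ip \<phi> * B"
        using ip_norm_nonneg[OF \<phi>] by (simp add: mult_left_mono)
    qed (use a in auto)
    then show ?thesis
      by (simp add: eq algebra_simps)
  qed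
  then show ?thesis
    by (rule that)
qed

text \<open>Riesz provides an abstract representer g in \<open>H\<close>. Testing g against the
  features computes its values, which are the pointwise integrals, so membership in \<open>H\<close>
  follows without integrating \<open>H\<close>-valued functions.\<close>

lemma integrate_feature_representer:
  assumes a: "a \<in> {0..T}"
  shows "integrate_feature a (\<lambda>s. feature s v) \<in> H"
    and "\<phi> \<in> H \<Longrightarrow> ip \<phi> (integrate_feature a (\<lambda>s. feature s v)) = integral {0..a} \<phi> \<bullet> v"
proof -
  obtain C where "\<And>\<phi>. \<phi> \<in> H \<Longrightarrow> \<bar>integral {0..a} \<phi> \<bullet> v\<bar> \<le> C * ip_norm ip \<phi>"
    using integral_inner_bounded[OF a] by blast
  then have "\<exists>g\<in>H. \<forall>\<phi>\<in>H. ip \<phi> g = integral {0..a} \<phi> \<bullet> v"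
    using Henstock_Kurzweil_Integration.integral_add[OF integrable_mem[OF _ a] integrable_mem[OF _ a]]
    by (intro riesz_representation) (auto simp: inner_add_left)
  then obtain g where g: "g \<in> H" and rep: "\<And>\<phi>. \<phi> \<in> H \<Longrightarrow> ip \<phi> g = integral {0..a} \<phi> \<bullet> v"
    by blast
  have "g t = integrate_feature a (\<lambda>s. feature s v) t" for t
  proof (cases "t \<in> {0..T}")
    case t: True
    have int: "(\<lambda>s. K t s *v v) integrable_on {0..a}"
      using a t by (intro integrable_continuous_interval continuous_on_kernel_mult) auto
    have "g t \<bullet> w = integral {0..a} (\<lambda>s. K t s *v v) \<bullet> w" for w
    proof -
      have "g t \<bullet> w = ip (feature t w) g"
        using reproducing[OF t g] ip_commute[OF g feature_mem[OF t]] by simp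
      also have "\<dots> = integral {0..a} (\<lambda>s. feature t w s \<bullet> v)"
        using rep[OF feature_mem[OF t]]
          integral_linear[OF integrable_mem[OF feature_mem[OF t] a] bounded_linear_inner_left]
        by (simp add: o_def)
      \<comment> \<open>The feature at t, evaluated at s, contains \<open>K s t\<close>; kernel
        symmetry moves the integration variable to the second argument.\<close>
      also have "\<dots> = integral {0..a} (\<lambda>s. (K t s *v v) \<bullet> w)"
        using a t by (intro Henstock_Kurzweil_Integration.integral_cong)
          (auto simp: feature_map_def kernel_inner[of _ t])
      also have "\<dots> = integral {0..a} (\<lambda>s. K t s *v v) \<bullet> w"
        using integral_linear[OF int bounded_linear_inner_left] by (simp add: o_def)
      finally show ?thesis .
    qed
    then have "g t = integral {0..a} (\<lambda>s. K t s *v v)"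
      using vector_eq_rdot by blast
    then show ?thesis
      using t by (simp add: integrate_feature_def feature_map_def)
  next
    case False
    then show ?thesis
      using zero_outside[OF g False] by (auto simp: integrate_feature_def feature_map_def)
  qed
  then have "g = integrate_feature a (\<lambda>s. feature s v)"
    by (rule ext)
  with g rep show "integrate_feature a (\<lambda>s. feature s v) \<in> H"
    and "\<phi> \<in> H \<Longrightarrow> ip \<phi> (integrate_feature a (\<lambda>s. feature s v)) = integral {0..a} \<phi> \<bullet> v"
    by auto
qed

text \<open>The blocks of the Gram matrix arise here: multiplication by v is linear in the matrix
  and is pulled out of both integrals.\<close>

lemma integral_integrate_feature:
  assumes "\<tau> i \<in> {0..T}" "\<tau> j \<in> {0..T}"
  shows "integral {0..\<tau> i} (integrate_feature (\<tau> j) (\<lambda>s. feature s v)) = gram_block K \<tau> i j *v v"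
proof -
  note bl = bounded_linear_matrix_vector_mult_left[of v]
  have inner: "(\<lambda>t. K s t) integrable_on {0..\<tau> j}" if "s \<in> {0..\<tau> i}" for s
    using assms that by (intro integrable_continuous_interval continuous_on_kernel) auto
  \<comment> \<open>The inner integral is continuous in s, which makes the outer one exist;
    \<open>cbox\<close> is the form in which \<open>integral_continuous_on_param\<close> takes the
    interval.\<close>
  have "continuous_on ({0..\<tau> i} \<times> cbox 0 (\<tau> j)) (\<lambda>(s, t). K s t)"
    using assms by (intro continuous_on_subset[OF continuous_kernel]) auto
  then have "continuous_on {0..\<tau> i} (\<lambda>s. integral (cbox 0 (\<tau> j)) (K s))"
    by (rule integral_continuous_on_param)
  then have outer: "(\<lambda>s. integral {0..\<tau> j} (\<lambda>t. K s t)) integrable_on {0..\<tau> i}"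
    by (simp add: integrable_continuous_interval)
  have "integral {0..\<tau> i} (integrate_feature (\<tau> j) (\<lambda>s. feature s v)) =
      integral {0..\<tau> i} (\<lambda>s. integral {0..\<tau> j} (\<lambda>t. K s t) *v v)"
  proof (intro Henstock_Kurzweil_Integration.integral_cong)
    fix s assume s: "s \<in> {0..\<tau> i}"
    then show "integrate_feature (\<tau> j) (\<lambda>s. feature s v) s = integral {0..\<tau> j} (\<lambda>t. K s t) *v v"
      using integral_linear[OF inner[OF s] bl] assms
      by (simp add: o_def integrate_feature_def feature_map_def)
  qed
  also have "\<dots> = gram_block K \<tau> i j *v v"
    using integral_linear[OF outer bl] by (simp add: o_def gram_block_def)
  finally show ?thesis .
qed

end

section \<open>Block vectors and the regularized linear system\<close>

lemma sum_UNIV_prod: "(\<Sum>p\<in>UNIV. f p) = (\<Sum>i\<in>UNIV. \<Sum>k\<in>UNIV. f (i, k))"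
  by (simp add: sum.cartesian_product)

lemma inner_eq_sum_block:
  fixes u v :: "real ^ ('n::finite \<times> 'd::finite)"
  shows "u \<bullet> v = (\<Sum>i\<in>UNIV. block u i \<bullet> block v i)"
  by (simp add: inner_vec_def block_def sum_UNIV_prod)

lemma block_gram_mult:
  "block (gram K \<tau> *v v) i = (\<Sum>j\<in>UNIV. gram_block K \<tau> i j *v block v j)"
  by (simp add: vec_eq_iff block_def gram_def matrix_vector_mult_def sum_UNIV_prod)

lemma block_eqI: "(\<And>i. block u i = block v i) \<Longrightarrow> u = v"
  by (auto simp: vec_eq_iff block_def)

text \<open>Pairing with v shows that G + lam I is injective, hence surjective in finite dimension.
  For symmetric G the gradient of the coefficient objective is 2 G (G v + lam v - b), so a solution
  is a stationary point.\<close>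

lemma regularized_system_solvable:
  fixes G :: "real ^ 'm ^ 'm"
  assumes "0 < lam" and psd: "\<And>v. 0 \<le> v \<bullet> (G *v v)"
  obtains v where "G *v v + lam *\<^sub>R v = b"
proof -
  let ?f = "\<lambda>v. G *v v + lam *\<^sub>R v"
  have lin: "linear ?f"
    by (intro linearI) (auto simp: matrix_vector_mult_scaleR algebra_simps)
  have "v = 0" if "?f v = 0" for v
  proof -
    have "v \<bullet> (G *v v) + lam * (v \<bullet> v) = v \<bullet> ?f v"
      by (simp add: inner_add_right)
    then have "lam * (v \<bullet> v) \<le> 0"
      using psd[of v] that by simp
    then have "v \<bullet> v \<le> 0"
      using \<open>0 < lam\<close> by (simp add: mult_le_0_iff)
    then show ?thesis
      by (metis inner_eq_zero_iff inner_ge_zero order_antisym)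
  qed
  then have "inj ?f"
    using linear_injective_0[OF lin] by blast
  then have "surj ?f"
    by (rule linear_inj_imp_surj[OF lin])
  then obtain v where "b = ?f v"
    by (rule surjE)
  then show ?thesis
    by (intro that[of v]) (rule sym)
qed

section \<open>Comparison of the two minimisation problems\<close>

theorem corollary3p3:
  fixes T :: real
    and K :: "real \<Rightarrow> real \<Rightarrow> real ^ 'd ^ 'd"
    and H :: "(real \<Rightarrow> real ^ 'd) set"
    and ip :: "(real \<Rightarrow> real ^ 'd) \<Rightarrow> (real \<Rightarrow> real ^ 'd) \<Rightarrow> real"
    and \<tau> :: "'n::finite \<Rightarrow> real"
    and y :: "'n \<Rightarrow> real ^ 'd"
    and x0 :: "real ^ 'd"
    and lam :: real
  assumes "0 < T"
    and "vector_rkhs {0..T} K H ip"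
    and "continuous_on ({0..T} \<times> {0..T}) (\<lambda>(s, t). K s t)"
    and "\<And>i. \<tau> i \<in> {0..T}"
    and "0 < lam"
  shows "(\<exists>!\<phi>. is_arg_min (rkhs_objective ip \<tau> y x0 lam) (\<lambda>\<phi>. \<phi> \<in> H) \<phi>) \<and>
    (\<exists>v. is_arg_min (coeff_objective (gram K \<tau>) (data_vector y x0) lam) (\<lambda>v. True) v) \<and>
    (\<forall>\<phi> v. is_arg_min (rkhs_objective ip \<tau> y x0 lam) (\<lambda>\<phi>. \<phi> \<in> H) \<phi> \<longrightarrow>
       is_arg_min (coeff_objective (gram K \<tau>) (data_vector y x0) lam) (\<lambda>v. True) v \<longrightarrow>
       \<phi> = (\<lambda>t. \<Sum>i\<in>UNIV. integrate_feature (\<tau> i) (\<lambda>s. feature_map {0..T} K s (block v i)) t))"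
proof -
  interpret continuous_rkhs T K H ip
    using assms(2,3) by (simp add: continuous_rkhs_def continuous_rkhs_axioms_def)
  define A where "A \<phi> = (\<chi> p. integral {0..\<tau> (fst p)} \<phi> $ snd p)" for \<phi> :: "real \<Rightarrow> real ^ 'd"
  define L where
    "L v = (\<lambda>t. \<Sum>i\<in>UNIV. integrate_feature (\<tau> i) (\<lambda>s. feature s (block v i)) t)" for v
  define b where "b = data_vector y x0"
  define J where "J = rkhs_objective ip \<tau> y x0 lam"
  define G where "G = gram K \<tau>"
  define c where "c = coeff_objective G b lam"
  have block_A: "block (A \<phi>) i = integral {0..\<tau> i} \<phi>" for \<phi> i
    by (simp add: A_def block_def)
  have L_mem: "L v \<in> H" for v
    unfolding L_def using assms(4) by (intro sum_mem integrate_feature_representer) auto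
  have adjoint: "ip \<phi> (L v) = A \<phi> \<bullet> v" if "\<phi> \<in> H" for \<phi> v
    unfolding L_def inner_eq_sum_block block_A
    using assms(4) that by (simp add: ip_sum_right integrate_feature_representer)
  have A_L: "A (L v) = G *v v" for v
  proof (rule block_eqI)
    fix i
    have "integral {0..\<tau> i} (L v) =
        (\<Sum>j\<in>UNIV. integral {0..\<tau> i} (integrate_feature (\<tau> j) (\<lambda>s. feature s (block v j))))"
      unfolding L_def
      using assms(4) by (intro integral_sum integrable_mem integrate_feature_representer) auto
    then show "block (A (L v)) i = block (G *v v) i"
      using assms(4) by (simp add: block_A G_def block_gram_mult integral_integrate_feature)
  qed
  have A_add: "A (\<lambda>x. \<phi> x + \<psi> x) = A \<phi> + A \<psi>" if "\<phi> \<in> H" "\<psi> \<in> H" for \<phi> \<psi>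
    using that assms(4)
    by (simp add: A_def vec_eq_iff Henstock_Kurzweil_Integration.integral_add integrable_mem)
  have J_eq: "J \<phi> = (A \<phi> - b) \<bullet> (A \<phi> - b) + lam * ip \<phi> \<phi>" if "\<phi> \<in> H" for \<phi>
  proof -
    have "block (A \<phi> - b) i = x0 + integral {0..\<tau> i} \<phi> - y i" for i
      by (simp add: vec_eq_iff block_def A_def b_def data_vector_def)
    then show ?thesis
      using that by (simp add: J_def rkhs_objective_def inner_eq_sum_block ip_norm_power2 dot_square_norm)
  qed
  \<comment> \<open>The residuals agree because A L = G, and the penalties because the squared norm
    of \<open>L v\<close> is A (L v) . v = v . G v.\<close>
  have c_eq: "c v = J (L v)" for v
    by (simp add: c_def coeff_objective_def J_eq L_mem adjoint A_L dot_square_norm inner_commute)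
  \<comment> \<open>v . G v is the squared norm of \<open>L v\<close>, so positivity comes from the
    inner product of \<open>H\<close>.\<close>
  have "0 \<le> v \<bullet> (G *v v)" for v
    using ip_nonneg[OF L_mem, of v] by (simp add: adjoint L_mem A_L inner_commute)
  then obtain v0 where v0: "G *v v0 + lam *\<^sub>R v0 = b"
    using regularized_system_solvable[OF assms(5), of G b] by blast
  have expand: "J \<phi> = J (L v0) + (norm (A h))\<^sup>2 + lam * ip h h"
    if \<phi>: "\<phi> \<in> H" and h: "h = (\<lambda>x. \<phi> x - L v0 x)" for \<phi> h
  proof -
    have h_mem: "h \<in> H"
      using diff_mem[OF \<phi> L_mem] h by simp
    have \<phi>_eq: "\<phi> = (\<lambda>x. L v0 x + h x)"
      by (simp add: h)
    \<comment> \<open>By the system for \<open>v0\<close> the residual at \<open>L v0\<close> is -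
      lam v0. Its cross term - 2 lam (A h . v0) cancels the cross term 2 lam ip h (L v0) of the
      penalty, by adjointness.\<close>
    have A_\<phi>: "A \<phi> - b = A h - lam *\<^sub>R v0"
      unfolding \<phi>_eq A_add[OF L_mem h_mem] A_L v0[symmetric] by simp
    have A_v0: "A (L v0) - b = - (lam *\<^sub>R v0)"
      unfolding A_L v0[symmetric] by simp
    have "ip \<phi> \<phi> = ip (L v0) (L v0) + 2 * ip h (L v0) + ip h h"
      using ip_add_scaleR_self[OF L_mem h_mem, of v0 1] ip_commute[OF L_mem h_mem, of v0]
      by (simp flip: \<phi>_eq)
    then show ?thesis
      unfolding J_eq[OF \<phi>] J_eq[OF L_mem] A_\<phi> A_v0
      by (simp add: adjoint[OF h_mem] power2_norm_eq_inner inner_diff_left inner_diff_right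
          inner_commute algebra_simps)
  qed
  have min: "J (L v0) \<le> J \<phi>" if "\<phi> \<in> H" for \<phi>
    using expand[OF that refl] ip_nonneg[OF diff_mem[OF that L_mem]] assms(5) by simp
  \<comment> \<open>The term in lam forces uniqueness: it vanishes at a further minimiser, and the
    inner product is definite.\<close>
  have unique: "\<phi> = L v0" if \<phi>: "\<phi> \<in> H" and le: "J \<phi> \<le> J (L v0)" for \<phi>
  proof -
    have mem: "(\<lambda>x. \<phi> x - L v0 x) \<in> H"
      by (rule diff_mem[OF \<phi> L_mem])
    have "lam * ip (\<lambda>x. \<phi> x - L v0 x) (\<lambda>x. \<phi> x - L v0 x) \<le> 0"
      using expand[OF \<phi> refl] le by (smt (verit) zero_le_power2)
    then have "ip (\<lambda>x. \<phi> x - L v0 x) (\<lambda>x. \<phi> x - L v0 x) = 0"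
      using assms(5) ip_nonneg[OF mem] by (simp add: mult_le_0_iff)
    from ip_definite[OF mem this] show ?thesis
      by (auto simp: fun_eq_iff)
  qed
  have arg_min_J: "is_arg_min J (\<lambda>\<phi>. \<phi> \<in> H) \<phi> \<longleftrightarrow> \<phi> = L v0" for \<phi>
    using min unique L_mem by (auto simp: is_arg_min_linorder)
  \<comment> \<open>Since \<open>c\<close> is \<open>J\<close> after \<open>L\<close>, minimality
    determines \<open>L v\<close> but, for singular \<open>G\<close>, not \<open>v\<close>. This is
    why an arbitrary coefficient solution yields the same function; \<open>v0\<close> witnesses
    existence.\<close>
  have arg_min_c: "is_arg_min c (\<lambda>v. True) v \<longleftrightarrow> L v = L v0" for v
    using min unique L_mem by (auto simp: is_arg_min_linorder c_eq)
  show ?thesis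
    unfolding J_def[symmetric] G_def[symmetric] b_def[symmetric] c_def[symmetric]
      L_def[symmetric] arg_min_J arg_min_c
    by auto
qed


end
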